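(* For $\alpha\in\mathbb{C}$ let $R_\alpha = |\alpha|^2+1+\sqrt{|\alpha|^2+1}$. Then: (1) If $\alpha\in\mathbb{C}$, then $\mathcal{M}(\alpha)\subseteq \overline{D(0,R_\alpha)}=\{c\in\mathbb{C} : |c|\le R_\alpha\}$. (2) If $\alpha\in\mathbb{R}$, then $\mathcal{M}(\alpha)\cap\mathbb{R}\subseteq [-R_\alpha, 1/4]$ when $|\alpha|\le 1/2$, and $\mathcal{M}(\alpha)\cap\mathbb{R}\subseteq [-R_\alpha, |\alpha|-\alpha^2]$ when $|\alpha|>1/2$.
   Context: For $c\in\mathbb{C}$ let $f_c(x)=x^2+c$, and let $f_c^n$ denote the $n$-fold composition of $f_c$ with itself. For $\alpha\in\mathbb{C}$, the generalized Mandelbrot set is $\mathcal{M}(\alpha)=\{c\in\mathbb{C} : \sup_{n\in\mathbb{N}}|f_c^n(\alpha)|<+\infty\}$ (equivalently, the set of $c\in\mathbb{C}$ such that $|f_c^n(\alpha)|\not\to\infty$ as $n\to\infty$). *)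

theory Defs
  imports "HOL-Analysis.Analysis"
begin

definition quad :: "complex \<Rightarrow> complex \<Rightarrow> complex" where
  "quad c x = x\<^sup>2 + c"

text \<open>
  Finiteness of the supremum is boundedness from above; the real-valued \<open>SUP\<close> would be
  unspecified for unbounded orbits.
\<close>

definition gen_mandelbrot :: "complex \<Rightarrow> complex set" where
  "gen_mandelbrot \<alpha> = {c. bdd_above (range (\<lambda>n. cmod ((quad c ^^ n) \<alpha>)))}"

definition mandelbrot_radius :: "complex \<Rightarrow> real" where
  "mandelbrot_radius \<alpha> = (cmod \<alpha>)\<^sup>2 + 1 + sqrt ((cmod \<alpha>)\<^sup>2 + 1)"

end

theory Submission
  imports Defs
begin

text \<open>
  An orbit is unbounded once it enters a forward invariant region on which \<open>quad c\<close> increases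
  the modulus by at least a fixed \<open>\<delta> > 0\<close>. In each case the first iterate of \<open>\<alpha>\<close> lies in such
  a region: for (1) the exterior \<open>|z| \<ge> |c| - |\<alpha>|\<^sup>2\<close>, for (2) the real half-line
  \<open>x \<ge> 0\<close> or \<open>x \<ge> |\<alpha>|\<close>.
\<close>

text \<open>By induction the iterate of index \<open>Suc n\<close> has modulus at least
  \<open>real n * \<delta>\<close>. The count starts at \<open>quad c \<alpha>\<close> because
  \<open>\<alpha>\<close> itself may lie outside \<open>P\<close>.\<close>

lemma not_in_gen_mandelbrot_if_escape:
  assumes start: "P (quad c \<alpha>)"
    and step: "\<And>z. P z \<Longrightarrow> P (quad c z) \<and> cmod z + \<delta> \<le> cmod (quad c z)"
    and "\<delta> > 0"
  shows "c \<notin> gen_mandelbrot \<alpha>"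
proof
  assume "c \<in> gen_mandelbrot \<alpha>"
  then obtain B where B: "\<And>n. cmod ((quad c ^^ n) \<alpha>) \<le> B"
    unfolding gen_mandelbrot_def bdd_above_def by auto
  have growth: "P ((quad c ^^ Suc n) \<alpha>) \<and> real n * \<delta> \<le> cmod ((quad c ^^ Suc n) \<alpha>)" for n
  proof (induction n)
    case 0
    show ?case using start by simp
  next
    case (Suc n)
    from step[OF conjunct1[OF Suc.IH]] Suc.IH show ?case
      by (simp add: algebra_simps)
  qed
  obtain n where "B < real n * \<delta>"
    using reals_Archimedean3[OF \<open>\<delta> > 0\<close>] by blast
  with growth[of n] B[of "Suc n"] show False by linarith
qed

lemma gen_mandelbrot_subset_cball:
  "gen_mandelbrot \<alpha> \<subseteq> cball 0 (mandelbrot_radius \<alpha>)"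
proof
  fix c assume c: "c \<in> gen_mandelbrot \<alpha>"
  show "c \<in> cball 0 (mandelbrot_radius \<alpha>)"
  proof (rule ccontr)
    assume "c \<notin> cball 0 (mandelbrot_radius \<alpha>)"
    define s where "s = sqrt ((cmod \<alpha>)\<^sup>2 + 1)"
    define t where "t = cmod c - (cmod \<alpha>)\<^sup>2"
    have s: "s \<ge> 0" "s\<^sup>2 = (cmod \<alpha>)\<^sup>2 + 1" by (simp_all add: s_def)
    have t: "t > s + 1"
      using \<open>c \<notin> _\<close> by (simp add: mandelbrot_radius_def s_def t_def)
    \<comment> \<open>The gain in modulus at \<open>z\<close> is at least
      \<open>r\<^sup>2 - r - cmod c\<close> with \<open>r = cmod z\<close>; \<open>\<delta>\<close>
      is its value at the boundary \<open>r = t\<close>. Completing the square below shows where the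
      radius comes from: for \<open>t \<ge> 1\<close>, \<open>\<delta>\<close> is positive exactly
      when \<open>t > s + 1\<close>.\<close>
    define \<delta> where "\<delta> = t\<^sup>2 - t - cmod c"
    have "\<delta> = (t - 1)\<^sup>2 - s\<^sup>2"
      unfolding s(2) by (simp add: \<delta>_def t_def power2_eq_square algebra_simps)
    moreover have "s\<^sup>2 < (t - 1)\<^sup>2"
      using s t by (intro power_strict_mono) auto
    ultimately have \<delta>: "\<delta> > 0" by simp
    \<comment> \<open>Both signs matter: \<open>c\<close> dominates at the starting point
      \<open>\<alpha>\<close>, the square dominates inside the region.\<close>
    have quad_lower: "\<bar>(cmod z)\<^sup>2 - cmod c\<bar> \<le> cmod (quad c z)" for z
      using norm_triangle_ineq3[of "z\<^sup>2" "- c"] by (simp add: quad_def norm_power)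
    have "c \<notin> gen_mandelbrot \<alpha>"
    proof (rule not_in_gen_mandelbrot_if_escape[where P = "\<lambda>z. t \<le> cmod z", OF _ _ \<delta>])
      show "t \<le> cmod (quad c \<alpha>)"
        using quad_lower[of \<alpha>] by (simp add: t_def)
      fix z assume z: "t \<le> cmod z"
      \<comment> \<open>The product is the difference of the values of \<open>r\<^sup>2 - r\<close>
        at \<open>cmod z\<close> and at \<open>t\<close>.\<close>
      have "0 \<le> (cmod z - t) * (cmod z + t - 1)"
        using z s t by (intro mult_nonneg_nonneg) auto
      then have "\<delta> \<le> (cmod z)\<^sup>2 - cmod z - cmod c"
        by (simp add: \<delta>_def power2_eq_square algebra_simps)
      with quad_lower[of z] z \<delta>
      show "t \<le> cmod (quad c z) \<and> cmod z + \<delta> \<le> cmod (quad c z)" by linarith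
    qed
    with c show False by contradiction
  qed
qed

text \<open>The half-line from \<open>L\<close> is invariant by \<open>incr\<close>, and
  \<open>L \<ge> 0\<close> turns the increase of \<open>x\<close> into an increase of
  modulus.\<close>

lemma real_not_in_gen_mandelbrot:
  fixes \<alpha> c \<delta> L :: real
  assumes "L \<ge> 0" "\<delta> > 0" "L \<le> \<alpha>\<^sup>2 + c"
    and incr: "\<And>x. L \<le> x \<Longrightarrow> x + \<delta> \<le> x\<^sup>2 + c"
  shows "complex_of_real c \<notin> gen_mandelbrot (complex_of_real \<alpha>)"
proof (rule not_in_gen_mandelbrot_if_escape[where P = "\<lambda>z. \<exists>x\<ge>L. z = complex_of_real x", OF _ _ \<open>\<delta> > 0\<close>])
  have quad_of_real: "quad (complex_of_real c) (complex_of_real x) = complex_of_real (x\<^sup>2 + c)" for x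
    by (simp add: quad_def)
  show "\<exists>x\<ge>L. quad (complex_of_real c) (complex_of_real \<alpha>) = complex_of_real x"
    using assms(3) quad_of_real by blast
  fix z assume "\<exists>x\<ge>L. z = complex_of_real x"
  then obtain x where x: "x \<ge> L" "z = complex_of_real x" by blast
  show "(\<exists>x\<ge>L. quad (complex_of_real c) z = complex_of_real x) \<and>
      cmod z + \<delta> \<le> cmod (quad (complex_of_real c) z)"
  proof
    show "\<exists>x\<ge>L. quad (complex_of_real c) z = complex_of_real x"
      using x quad_of_real incr[OF x(1)] \<open>\<delta> > 0\<close> by (intro exI[of _ "x\<^sup>2 + c"]) auto
    show "cmod z + \<delta> \<le> cmod (quad (complex_of_real c) z)"
      unfolding x(2) quad_of_real norm_of_real using incr[OF x(1)] x(1) assms(1,2) by linarith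
  qed
qed

text \<open>Since \<open>x\<^sup>2 - x + 1/4\<close> is a square, each step on the real line gains
  at least \<open>c - 1/4\<close>.\<close>

lemma real_gen_mandelbrot_le_quarter:
  assumes "complex_of_real c \<in> gen_mandelbrot (complex_of_real \<alpha>)"
  shows "c \<le> 1/4"
proof (rule ccontr)
  assume c: "\<not> c \<le> 1/4"
  have "x + (c - 1/4) \<le> x\<^sup>2 + c" for x :: real
    using zero_le_power2[of "x - 1/2"] by (simp add: power2_eq_square algebra_simps)
  with c have "complex_of_real c \<notin> gen_mandelbrot (complex_of_real \<alpha>)"
    by (intro real_not_in_gen_mandelbrot[where L = 0 and \<delta> = "c - 1/4"]) auto
  with assms show False by contradiction
qed

text \<open>At \<open>c = \<bar>\<alpha>\<bar> - \<alpha>\<^sup>2\<close> the point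
  \<open>\<bar>\<alpha>\<bar>\<close> is fixed. For larger \<open>c\<close> the gain there is
  positive, and it does not decrease to the right because \<open>x\<^sup>2 - x\<close> is increasing
  beyond \<open>1/2\<close>.\<close>

lemma real_gen_mandelbrot_le:
  assumes "complex_of_real c \<in> gen_mandelbrot (complex_of_real \<alpha>)" and \<alpha>: "\<bar>\<alpha>\<bar> > 1/2"
  shows "c \<le> \<bar>\<alpha>\<bar> - \<alpha>\<^sup>2"
proof (rule ccontr)
  assume c: "\<not> c \<le> \<bar>\<alpha>\<bar> - \<alpha>\<^sup>2"
  have "x + (c - (\<bar>\<alpha>\<bar> - \<alpha>\<^sup>2)) \<le> x\<^sup>2 + c" if "\<bar>\<alpha>\<bar> \<le> x" for x
  proof -
    have "0 \<le> (x - \<bar>\<alpha>\<bar>) * (x + \<bar>\<alpha>\<bar> - 1)"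
      using that \<alpha> by (intro mult_nonneg_nonneg) auto
    then show ?thesis by (simp add: power2_eq_square algebra_simps)
  qed
  with c have "complex_of_real c \<notin> gen_mandelbrot (complex_of_real \<alpha>)"
    by (intro real_not_in_gen_mandelbrot[where L = "\<bar>\<alpha>\<bar>" and \<delta> = "c - (\<bar>\<alpha>\<bar> - \<alpha>\<^sup>2)"]) auto
  with assms(1) show False by contradiction
qed

theorem theorem1p1:
  shows "(\<forall>\<alpha>::complex. gen_mandelbrot \<alpha> \<subseteq> cball 0 (mandelbrot_radius \<alpha>)) \<and>
    (\<forall>\<alpha>::real.
      (\<bar>\<alpha>\<bar> \<le> 1/2 \<longrightarrow> gen_mandelbrot (complex_of_real \<alpha>) \<inter> \<real>
         \<subseteq> complex_of_real ` {- mandelbrot_radius (complex_of_real \<alpha>) .. 1/4}) \<and>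
      (\<bar>\<alpha>\<bar> > 1/2 \<longrightarrow> gen_mandelbrot (complex_of_real \<alpha>) \<inter> \<real>
         \<subseteq> complex_of_real ` {- mandelbrot_radius (complex_of_real \<alpha>) .. \<bar>\<alpha>\<bar> - \<alpha>\<^sup>2}))"
proof -
  \<comment> \<open>The left endpoint in both real cases is inherited from the complex disc.\<close>
  have lower: "- mandelbrot_radius (complex_of_real \<alpha>) \<le> c"
    if "complex_of_real c \<in> gen_mandelbrot (complex_of_real \<alpha>)" for \<alpha> c
    using subsetD[OF gen_mandelbrot_subset_cball that] by simp
  show ?thesis
    using gen_mandelbrot_subset_cball lower real_gen_mandelbrot_le_quarter real_gen_mandelbrot_le
    by (fastforce elim!: Reals_cases)
qed

end
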